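(* Let $0<q\le 1$, $0\le\theta\le1$, and let $k\ge1$ be an integer. For integers $n\ge0$ and $r\ge1$ let $$\rho_q(r;n,k;\theta)=E_{q,\theta}\big[E_{n,k}(E_{n,k}-1)\cdots(E_{n,k}-r+1)\big],\qquad \nu_q(r;n,k;\theta)=E_{q,\theta}\big(E_{n,k}^{\,r}\big),$$ and let $\rho_q(0;n,k;\theta)=\nu_q(0;n,k;\theta)=1$ for $n\ge 0$. Then for all integers $n>k+1$ and $r\ge1$, $$\begin{aligned}\rho_q(r;n,k;\theta)=\ &\theta\rho_q(r;n-1,k;\theta)+(1-\theta)\Big\{\rho_q(r;n-1,k;\theta q)\\&+\theta^{k}r\,\rho_q(r-1;n-k-1,k;\theta q)-\theta^{k+1}r\,\rho_q(r-1;n-k-2,k;\theta q)\Big\},\end{aligned}$$ where for $r\ge1$: $\rho_q(r;n,k;\theta)=0$ for $0\le n<k$, $\rho_q(r;k,k;\theta)=\theta^{k}\delta_{r,1}$, and $\rho_q(r;k+1,k;\theta)=\theta^{k}(1-\theta)(1+q^{k})\delta_{r,1}$; and $$\begin{aligned}\nu_q(r;n,k;\theta)=\ &\theta\nu_q(r;n-1,k;\theta)+(1-\theta)\Big\{\nu_q(r;n-1,k;\theta q)\\&+\theta^{k}\sum_{i=0}^{r-1}\binom{r}{i}\nu_q(i;n-k-1,k;\theta q)-\theta^{k+1}\sum_{i=0}^{r-1}\binom{r}{i}\nu_q(i;n-k-2,k;\theta q)\Big\},\end{aligned}$$ where for $r\ge1$: $\nu_q(r;n,k;\theta)=0$ for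 $0\le n<k$, $\nu_q(r;k,k;\theta)=\theta^{k}$, and $\nu_q(r;k+1,k;\theta)=\theta^{k}(1-\theta)(1+q^{k})$.
   Context: A $q$-sequence of binary trials with parameters $(\theta,q)$ is a sequence of $\{0,1\}$-valued random variables $X_1,X_2,\dots$ ($1$ = success, $0$ = failure) such that, conditionally on $X_1,\dots,X_{j-1}$, the probability that $X_j=1$ is $\theta q^{z}$, where $z=\sum_{m=1}^{j-1}(1-X_m)$ is the number of failures among the first $j-1$ trials (so the probability that $X_j=0$ is $1-\theta q^{z}$). For $q=1$ these are i.i.d. Bernoulli trials with success probability $\theta$. $E_{q,\theta}$ denotes expectation under this model. A success run of length exactly $k$ is a block of $k$ consecutive ones that is preceded by a zero or by the beginning of the sequence and followed by a zero or by the end of the sequence. $E_{n,k}$ counts the success runs of length exactly $k$ in $X_1,\dots,X_n$; $E_{0,k}=0$. $\delta_{a,b}$ is the Kronecker delta. *)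

theory Defs
  imports "HOL-Probability.Probability"
begin

text \<open>
  Sequences \<open>X 1, X 2, \<dots>\<close> are indexed from 1; the value \<open>X 0\<close> plays no role.  The law of the
  \<open>j\<close>-th trial given the past is stated for every history \<open>x 1, \<dots>, x (j - 1)\<close> of positive
  probability, as \<^const>\<open>cond_prob\<close> is set to 0 on null events.  For \<open>j = 1\<close> the history is
  empty and the condition says that \<open>X 1 = 1\<close> has probability \<open>\<theta>\<close>.
\<close>

definition q_sequence :: "'a measure \<Rightarrow> (nat \<Rightarrow> 'a \<Rightarrow> nat) \<Rightarrow> real \<Rightarrow> real \<Rightarrow> bool" where
  "q_sequence M X \<theta> q \<longleftrightarrow>
     prob_space M \<and>
     (\<forall>j\<ge>1. X j \<in> measurable M (count_space {0, 1})) \<and>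
     (\<forall>j\<ge>1. \<forall>x :: nat \<Rightarrow> nat.
        \<P>(\<omega> in M. \<forall>m\<in>{1..<j}. X m \<omega> = x m) > 0 \<longrightarrow>
        \<P>(\<omega> in M. X j \<omega> = 1 \<bar> \<forall>m\<in>{1..<j}. X m \<omega> = x m)
          = \<theta> * q ^ (\<Sum>m\<in>{1..<j}. 1 - x m))"

text \<open>
  A run is identified with its starting position \<open>i\<close>; it occupies the positions
  \<open>i, \<dots>, i + k - 1\<close> of \<open>1, \<dots>, n\<close>.
\<close>

definition success_runs :: "nat \<Rightarrow> nat \<Rightarrow> (nat \<Rightarrow> nat) \<Rightarrow> nat" where
  "success_runs n k x =
     card {i. 1 \<le> i \<and> i + k \<le> n + 1 \<and>
              (\<forall>m\<in>{i..<i + k}. x m = 1) \<and>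
              (i = 1 \<or> x (i - 1) = 0) \<and>
              (i + k = n + 1 \<or> x (i + k) = 0)}"

text \<open>
  For \<open>r = 0\<close> both moments are 1 over a probability space, since the empty product and the
  zeroth power are 1.
\<close>

definition run_factorial_moment ::
    "'a measure \<Rightarrow> (nat \<Rightarrow> 'a \<Rightarrow> nat) \<Rightarrow> nat \<Rightarrow> nat \<Rightarrow> nat \<Rightarrow> real" where
  "run_factorial_moment M X r n k =
     (\<integral>\<omega>. (\<Prod>i<r. real (success_runs n k (\<lambda>m. X m \<omega>)) - real i) \<partial>M)"

definition run_moment ::
    "'a measure \<Rightarrow> (nat \<Rightarrow> 'a \<Rightarrow> nat) \<Rightarrow> nat \<Rightarrow> nat \<Rightarrow> nat \<Rightarrow> real" where
  "run_moment M X r n k = (\<integral>\<omega>. real (success_runs n k (\<lambda>m. X m \<omega>)) ^ r \<partial>M)"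

lemma run_factorial_moment_0: "prob_space M \<Longrightarrow> run_factorial_moment M X 0 n k = 1"
  by (simp add: run_factorial_moment_def prob_space.prob_space)

lemma run_moment_0: "prob_space M \<Longrightarrow> run_moment M X 0 n k = 1"
  by (simp add: run_moment_def prob_space.prob_space)

text \<open>
  Every admissible pair of parameters has a \<open>q\<close>-sequence: toss independent coins \<open>w (m, c)\<close> with
  success probability \<open>\<theta> * q ^ c\<close> and let trial \<open>m + 1\<close> read the coin \<open>(m, c)\<close>, where \<open>c\<close> is the
  number of failures in the first \<open>m\<close> trials.
\<close>

fun coin_failures :: "(nat \<times> nat \<Rightarrow> bool) \<Rightarrow> nat \<Rightarrow> nat" where
  "coin_failures w 0 = 0"
| "coin_failures w (Suc j) = coin_failures w j + (if w (j, coin_failures w j) then 0 else 1)"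

lemma coin_failures_restrict: "m \<le> j \<Longrightarrow> coin_failures (restrict w {p. fst p < j}) m = coin_failures w m"
  by (induction m) auto

lemma q_sequence_exists:
  fixes \<theta> q :: real
  assumes "0 < q" "q \<le> 1" "0 \<le> \<theta>" "\<theta> \<le> 1"
  shows "\<exists>(M :: (nat \<times> nat \<Rightarrow> bool) measure) X. q_sequence M X \<theta> q"
proof -
  define p where "p = (\<lambda>c. \<theta> * q ^ c)"
  have p01: "0 \<le> p c" "p c \<le> 1" for c
    using assms by (auto simp: p_def intro!: mult_le_one power_le_one)
  define K where "K = (\<lambda>(m::nat, c). measure_pmf (bernoulli_pmf (p c)))"
  have psK: "prob_space (K i)" for i
    unfolding K_def by (cases i) (simp add: prob_space_measure_pmf)
  have setsK: "sets (K i) = sets (count_space UNIV)" for i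
    unfolding K_def by (cases i) simp
  have spK: "space (K i) = UNIV" for i
    unfolding K_def by (cases i) simp
  define M where "M = PiM UNIV K"
  interpret M: prob_space M unfolding M_def by (intro prob_space_PiM psK)
  have meascomp: "(\<lambda>w. w i) \<in> measurable (PiM S K) (count_space UNIV)" for S i
  proof (cases "i \<in> S")
    case True
    from measurable_component_singleton[OF this, of K]
    show ?thesis unfolding measurable_cong_sets[OF refl setsK] .
  next
    case False
    then have "(\<lambda>w. w i) \<in> measurable (PiM S K) (count_space UNIV) \<longleftrightarrow> (\<lambda>w. undefined) \<in> measurable (PiM S K) (count_space (UNIV::bool set))"
      by (intro measurable_cong) (metis False PiE_arb space_PiM)
    then show ?thesis by simp
  qed
  have measnf: "(\<lambda>w. coin_failures w j) \<in> measurable (PiM S K) (count_space UNIV)" for S j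
  proof (induction j)
    case (Suc j)
    note [measurable] = Suc meascomp
    have [measurable]: "(\<lambda>w. w (j, coin_failures w j)) \<in> measurable (PiM S K) (count_space UNIV)"
      by (rule measurable_compose_countable[where f="\<lambda>c w. w (j, c)" and g="\<lambda>w. coin_failures w j"]) measurable
    show ?case by simp
  qed simp
  have meastrial: "(\<lambda>w. w (j, coin_failures w j)) \<in> measurable (PiM S K) (count_space UNIV)" for S j
  proof -
    note [measurable] = measnf meascomp
    show ?thesis
      by (rule measurable_compose_countable[where f="\<lambda>c w. w (j, c)" and g="\<lambda>w. coin_failures w j"]) measurable
  qed
  define X :: "nat \<Rightarrow> (nat \<times> nat \<Rightarrow> bool) \<Rightarrow> nat"
    where "X = (\<lambda>j w. of_bool (w (j - 1, coin_failures w (j - 1))))"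
  have measX: "X j \<in> measurable (PiM S K) (count_space UNIV)" for S j
    unfolding X_def using meastrial[of "j-1" S] by measurable
  have measX': "X j \<in> measurable M (count_space {0,1})" for j
  proof -
    have "of_bool \<in> measurable (count_space UNIV) (count_space {0,1::nat})" by auto
    from measurable_compose[OF meastrial[of "j-1" UNIV] this] show ?thesis unfolding X_def M_def .
  qed
  have X_restrict: "X m (restrict w {p. fst p < j}) = X m w" if "1 \<le> m" "m \<le> j" for m j w
  proof -
    have "coin_failures (restrict w {p. fst p < j}) (m - 1) = coin_failures w (m - 1)"
      using that by (intro coin_failures_restrict) auto
    moreover have "m - 1 < j" using that by linarith
    ultimately show ?thesis by (simp add: X_def)
  qed
  have nfX: "coin_failures w j = (\<Sum>m\<in>{1..<Suc j}. 1 - X m w)" for w j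
    by (induction j) (auto simp: X_def)
  have ind: "M.indep_vars K (\<lambda>i w. w i) UNIV"
  proof -
    have "distr M (PiM UNIV K) (\<lambda>w. \<lambda>i\<in>UNIV. w i) = PiM UNIV (\<lambda>i. distr M (K i) (\<lambda>w. w i))"
      unfolding M_def by (simp add: distr_PiM_component psK restrict_UNIV)
    then show ?thesis
      by (subst M.indep_vars_iff_distr_eq_PiM) (auto simp: M_def)
  qed
  have coin: "M.prob {w\<in>space M. w (m, c)} = p c" for m c
  proof -
    have "M.prob {w\<in>space M. w (m, c)} = measure (distr M (K (m,c)) (\<lambda>w. w (m,c))) {True}"
      using meascomp[of "(m,c)" UNIV] unfolding M_def
      by (subst measure_distr) (auto simp: setsK vimage_def Int_def intro!: arg_cong[where f="measure _"])
    also have "\<dots> = measure (K (m,c)) {True}" unfolding M_def by (simp add: distr_PiM_component psK)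
    also have "\<dots> = p c" using p01[of c] by (simp add: K_def measure_pmf_single)
    finally show ?thesis .
  qed
  have main: "\<P>(w in M. X j w = 1 \<bar> \<forall>m\<in>{1..<j}. X m w = x m) = \<theta> * q ^ (\<Sum>m\<in>{1..<j}. 1 - x m)"
    if j: "j \<ge> 1" and pos: "\<P>(w in M. \<forall>m\<in>{1..<j}. X m w = x m) > 0" for j x
  proof -
    define c where "c = (\<Sum>m\<in>{1..<j}. 1 - x m)"
    define S where "S = {p::nat\<times>nat. fst p < j - 1}"
    define T where "T = {(j - 1, c)}"
    define A where "A = {w\<in>space M. \<forall>m\<in>{1..<j}. X m w = x m}"
    define A' where "A' = {w\<in>space (PiM S K). \<forall>m\<in>{1..<j}. X m w = x m}"
    define B where "B = {w\<in>space M. w (j - 1, c)}"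
    define B' where "B' = {w\<in>space (PiM T K). w (j - 1, c)}"
    have iv: "M.indep_var (PiM S K) (\<lambda>w. restrict (\<lambda>i. w i) S) (PiM T K) (\<lambda>w. restrict (\<lambda>i. w i) T)"
      by (rule M.indep_var_restrict[OF ind]) (auto simp: S_def T_def)
    note [measurable] = measX meascomp
    have A': "A' \<in> sets (PiM S K)" unfolding A'_def by measurable
    have B': "B' \<in> sets (PiM T K)" unfolding B'_def by measurable
    have XS: "X m (restrict w S) = X m w" if "m \<in> {1..<j}" for m w
      unfolding S_def using that by (intro X_restrict) auto
    have Aeq: "A = (\<lambda>w. restrict (\<lambda>i. w i) S) -` A' \<inter> space M"
      unfolding A_def A'_def by (auto simp: XS space_PiM spK M_def)
    have Beq: "B = (\<lambda>w. restrict (\<lambda>i. w i) T) -` B' \<inter> space M"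
      unfolding B_def B'_def by (auto simp: T_def space_PiM spK M_def)
    have "M.prob (A \<inter> B) = M.prob A * M.prob B"
      using M.indep_varD[OF iv A' B'] unfolding Aeq Beq
      by (simp add: vimage_def Int_def conj_ac)
    moreover have "{w\<in>space M. X j w = 1 \<and> (\<forall>m\<in>{1..<j}. X m w = x m)} = A \<inter> B"
    proof -
      have "coin_failures w (j - 1) = c" if "\<forall>m\<in>{1..<j}. X m w = x m" for w
        unfolding nfX c_def using j that by (intro sum.cong) auto
      then show ?thesis by (auto simp: A_def B_def X_def)
    qed
    ultimately show ?thesis
      using pos coin[of "j-1" c] by (simp add: cond_prob_def A_def B_def c_def p_def)
  qed
  have "q_sequence M X \<theta> q"
    unfolding q_sequence_def using M.prob_space_axioms measX' main by auto
  then show ?thesis by blast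
qed

end

theory Submission
  imports Defs
begin

text \<open>
  Condition on the number \<open>j\<close> of leading successes.  If \<open>j < n\<close>, then trial \<open>j + 1\<close> fails and the
  remaining \<open>n - j - 1\<close> trials form a \<open>q\<close>-sequence with parameter \<open>\<theta> q\<close>, whose run count has to be
  raised by one exactly when \<open>j = k\<close>.  In the difference between the resulting expansion of
  the mean of \<open>g (E_{n,k})\<close> and \<open>\<theta>\<close> times that of \<open>g (E_{n-1,k})\<close>, all terms cancel except those for
  \<open>j = 0\<close>, \<open>j = k\<close> and \<open>j = k + 1\<close>, and the last two carry the forward difference of \<open>g\<close>.  For a
  falling factorial or a power \<open>g\<close> this difference is the one in the recurrence.
\<close>

section \<open>Run counts of fixed 0-1 sequences and words\<close>

lemma success_runs_cong:
  assumes "\<And>m. m \<in> {1..n} \<Longrightarrow> x m = y m"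
  shows "success_runs n k x = success_runs n k y"
proof -
  have "(1 \<le> i \<and> i + k \<le> n + 1 \<and> (\<forall>m\<in>{i..<i + k}. x m = 1) \<and>
           (i = 1 \<or> x (i - 1) = 0) \<and> (i + k = n + 1 \<or> x (i + k) = 0)) \<longleftrightarrow>
        (1 \<le> i \<and> i + k \<le> n + 1 \<and> (\<forall>m\<in>{i..<i + k}. y m = 1) \<and>
           (i = 1 \<or> y (i - 1) = 0) \<and> (i + k = n + 1 \<or> y (i + k) = 0))" for i
  proof (cases "1 \<le> i \<and> i + k \<le> n + 1")
    case True
    have "x m = y m" if "m \<in> {i..<i + k}" for m
      using that True by (intro assms) auto
    then have "(\<forall>m\<in>{i..<i + k}. x m = 1) \<longleftrightarrow> (\<forall>m\<in>{i..<i + k}. y m = 1)"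
      by simp
    \<comment> \<open>The escape clauses of the definition cover exactly the neighbours at positions
      \<open>0\<close> and \<open>n + 1\<close>, so every neighbour that matters lies in
      \<open>{1..n}\<close>.\<close>
    moreover have "i = 1 \<or> x (i - 1) = y (i - 1)"
      using True by (cases "i = 1") (auto intro!: assms)
    moreover have "i + k = n + 1 \<or> x (i + k) = y (i + k)"
      using True by (cases "i + k = n + 1") (auto intro!: assms)
    ultimately show ?thesis by argo
  qed auto
  then show ?thesis
    unfolding success_runs_def by presburger
qed

lemma success_runs_eq_0:
  assumes "n < k"
  shows "success_runs n k x = 0"
proof -
  have "{i. 1 \<le> i \<and> i + k \<le> n + 1 \<and> (\<forall>m\<in>{i..<i + k}. x m = 1) \<and>
         (i = 1 \<or> x (i - 1) = 0) \<and> (i + k = n + 1 \<or> x (i + k) = 0)} = {}"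
    using assms by auto
  then show ?thesis
    unfolding success_runs_def by (simp only: card.empty)
qed

text \<open>A run that starts after position \<open>1\<close> or stops before \<open>n\<close> needs
  a bordering zero inside the sequence, and there is none. Only the whole block can count.\<close>

lemma success_runs_all_ones:
  assumes "\<And>m. m \<in> {1..n} \<Longrightarrow> x m = 1" "k \<ge> 1"
  shows "success_runs n k x = of_bool (n = k)"
proof -
  define S where "S = {i. 1 \<le> i \<and> i + k \<le> n + 1 \<and> (\<forall>m\<in>{i..<i + k}. x m = 1) \<and>
         (i = 1 \<or> x (i - 1) = 0) \<and> (i + k = n + 1 \<or> x (i + k) = 0)}"
  have "i = 1 \<and> n = k" if i: "i \<in> S" for i
  proof -
    have "i = 1"
    proof (rule ccontr)
      assume "i \<noteq> 1"
      then have "x (i - 1) = 0" "i - 1 \<in> {1..n}"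
        using i assms(2) by (auto simp: S_def)
      then show False
        using assms(1) by simp
    qed
    moreover have "i + k = n + 1"
    proof (rule ccontr)
      assume "i + k \<noteq> n + 1"
      then have "x (i + k) = 0" "i + k \<in> {1..n}"
        using i by (auto simp: S_def)
      then show False
        using assms(1) by simp
    qed
    ultimately show ?thesis by simp
  qed
  moreover have "1 \<in> S" if "n = k"
    using that assms(1) by (simp add: S_def)
  ultimately have S_eq: "S = (if n = k then {1} else {})"
    by (metis empty_iff equalityI insert_iff subsetI)
  have "success_runs n k x = card S"
    by (simp only: success_runs_def S_def)
  then show ?thesis
    by (simp add: S_eq)
qed

text \<open>No run contains the zero at \<open>Suc j\<close>. Before it only the whole leading block
  can be a run; after it the zero acts like the beginning of a sequence, so the later runs are those
  of the shifted tail.\<close>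

lemma success_runs_split:
  assumes ones: "\<And>m. m \<in> {1..j} \<Longrightarrow> x m = 1" and zero: "x (Suc j) = 0" and k: "k \<ge> 1"
  shows "success_runs (Suc j + n) k x = of_bool (j = k) + success_runs n k (\<lambda>m. x (m + Suc j))"
proof -
  define S where "S = {i. 1 \<le> i \<and> i + k \<le> Suc j + n + 1 \<and> (\<forall>m\<in>{i..<i + k}. x m = 1) \<and>
         (i = 1 \<or> x (i - 1) = 0) \<and> (i + k = Suc j + n + 1 \<or> x (i + k) = 0)}"
  define T where "T = {i. 1 \<le> i \<and> i + k \<le> n + 1 \<and> (\<forall>m\<in>{i..<i + k}. x (m + Suc j) = 1) \<and>
         (i = 1 \<or> x (i - 1 + Suc j) = 0) \<and> (i + k = n + 1 \<or> x (i + k + Suc j) = 0)}"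
  have low: "i = 1 \<and> j = k" if i: "i \<in> S" "i \<le> Suc j" for i
  proof -
    have run: "x m = 1" if "m \<in> {i..<i + k}" for m
      using i that by (auto simp: S_def)
    \<comment> \<open>Since \<open>k \<ge> 1\<close>, position \<open>i\<close> itself belongs to
      the run and cannot be the zero.\<close>
    have "i \<noteq> Suc j"
      using run[of i] zero k by auto
    then have "i = 1"
      using i ones[of "i - 1"] by (force simp: S_def)
    have "k \<le> j"
    proof (rule ccontr)
      assume "\<not> k \<le> j"
      then show False
        using run[of "Suc j"] zero \<open>i = 1\<close> by simp
    qed
    then have "x (1 + k) = 0"
      using i \<open>i = 1\<close> by (auto simp: S_def)
    then have "\<not> 1 + k \<le> j"
      using ones[of "1 + k"] by auto
    then show ?thesis
      using \<open>k \<le> j\<close> \<open>i = 1\<close> by simp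
  qed
  have one: "1 \<in> S" if "j = k"
    using that ones zero by (auto simp: S_def)
  have shift: "i + Suc j \<in> S \<longleftrightarrow> i \<in> T" if "1 \<le> i" for i
  proof -
    have ones_iff: "(\<forall>m\<in>{i + Suc j..<i + Suc j + k}. x m = 1) \<longleftrightarrow> (\<forall>m\<in>{i..<i + k}. x (m + Suc j) = 1)"
    proof -
      have "{i + Suc j..<i + Suc j + k} = (\<lambda>m. m + Suc j) ` {i..<i + k}"
        by (simp only: image_add_atLeastLessThan' add_ac)
      then show ?thesis by (simp only: Set.ball_simps)
    qed
    \<comment> \<open>For \<open>i = 1\<close> the left neighbour after shifting is the zero at
      \<open>Suc j\<close>, which matches the start of the tail.\<close>
    have left_iff: "(i + Suc j = 1 \<or> x (i + Suc j - 1) = 0) \<longleftrightarrow> (i = 1 \<or> x (i - 1 + Suc j) = 0)"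
      using that zero by (cases i) auto
    have end_iff: "i + Suc j + k = Suc j + n + 1 \<longleftrightarrow> i + k = n + 1"
      by auto
    have right_eq: "x (i + Suc j + k) = x (i + k + Suc j)" by (simp only: add_ac)
    have le_iff: "i + Suc j + k \<le> Suc j + n + 1 \<longleftrightarrow> i + k \<le> n + 1"
      by auto
    have "1 \<le> i + Suc j" by simp
    then show ?thesis
      using that unfolding S_def T_def mem_Collect_eq ones_iff left_iff end_iff right_eq le_iff
      by (simp only: simp_thms)
  qed
  have "S = (if j = k then {1} else {}) \<union> (\<lambda>i. i + Suc j) ` T"
  proof (intro equalityI subsetI)
    fix i assume i: "i \<in> S"
    show "i \<in> (if j = k then {1} else {}) \<union> (\<lambda>i. i + Suc j) ` T"
    proof (cases "i \<le> Suc j")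
      case True
      then show ?thesis using low[OF i] by simp
    next
      case False
      then have "i = (i - Suc j) + Suc j" "1 \<le> i - Suc j" by auto
      then show ?thesis
        using shift[of "i - Suc j"] i by (metis UnI2 image_eqI)
    qed
  next
    fix i assume "i \<in> (if j = k then {1} else {}) \<union> (\<lambda>i. i + Suc j) ` T"
    then show "i \<in> S"
    proof (elim UnE)
      assume "i \<in> (\<lambda>i. i + Suc j) ` T"
      then obtain i' where i': "i = i' + Suc j" "i' \<in> T"
        by blast
      then have "1 \<le> i'"
        by (simp add: T_def)
      then show "i \<in> S"
        using shift i' by blast
    qed (use one in \<open>auto split: if_splits\<close>)
  qed
  moreover have "finite T"
    by (rule finite_subset[of _ "{..n + 1}"]) (auto simp: T_def)
  moreover have "(if j = k then {1} else {}) \<inter> (\<lambda>i. i + Suc j) ` T = {}"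
    by (auto simp: T_def)
  ultimately have "card S = card (if j = k then {1::nat} else {}) + card ((\<lambda>i. i + Suc j) ` T)"
    using card_Un_disjoint[of "if j = k then {1} else {}" "(\<lambda>i. i + Suc j) ` T"] by simp
  also have "\<dots> = of_bool (j = k) + card T"
    by (subst card_image) (simp_all add: inj_on_def)
  finally have "card S = of_bool (j = k) + card T" .
  then show ?thesis
    unfolding success_runs_def S_def T_def by simp
qed

text \<open>Words list the trials \<open>1, 2, \<dots>\<close> from index \<open>0\<close> on.\<close>

definition runs :: "nat \<Rightarrow> bool list \<Rightarrow> nat" where
  "runs k xs = success_runs (length xs) k (\<lambda>m. of_bool (xs ! (m - 1)))"

lemma runs_eq_0: "length xs < k \<Longrightarrow> runs k xs = 0"
  by (simp add: runs_def success_runs_eq_0)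

lemma runs_replicate: "k \<ge> 1 \<Longrightarrow> runs k (replicate n True) = of_bool (n = k)"
  unfolding runs_def by (subst success_runs_all_ones) auto

lemma runs_split:
  assumes "k \<ge> 1"
  shows "runs k (replicate j True @ False # ys) = of_bool (j = k) + runs k ys"
proof -
  define x where "x = (\<lambda>m. of_bool ((replicate j True @ False # ys) ! (m - 1)) :: nat)"
  have "runs k (replicate j True @ False # ys) = success_runs (Suc j + length ys) k x"
    by (simp add: runs_def x_def)
  also have "\<dots> = of_bool (j = k) + success_runs (length ys) k (\<lambda>m. x (m + Suc j))"
    using assms by (intro success_runs_split) (auto simp: x_def nth_append)
  also have "success_runs (length ys) k (\<lambda>m. x (m + Suc j)) = runs k ys"
    unfolding runs_def by (rule success_runs_cong) (auto simp: x_def nth_append nth_Cons')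
  finally show ?thesis .
qed

section \<open>Law of a finite word and expectations under it\<close>

fun word_prob :: "real \<Rightarrow> real \<Rightarrow> bool list \<Rightarrow> real" where
  "word_prob q \<theta> [] = 1"
| "word_prob q \<theta> (x # xs) =
     (if x then \<theta> * word_prob q \<theta> xs else (1 - \<theta>) * word_prob q (\<theta> * q) xs)"

text \<open>The recursion of \<open>word_prob\<close> reads the first trial and passes each failure
  on as a factor \<open>q\<close> in the parameter, whereas \<open>q_sequence\<close> conditions the
  last trial on its past. Both views agree because the absorbed factors multiply to
  \<open>q ^ count_list xs False\<close>.\<close>

lemma word_prob_snoc:
  "word_prob q \<theta> (xs @ [x]) = word_prob q \<theta> xs *
     (if x then \<theta> * q ^ count_list xs False else 1 - \<theta> * q ^ count_list xs False)"
  by (induction xs arbitrary: \<theta>) (auto simp: algebra_simps)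

definition word_expectation :: "real \<Rightarrow> real \<Rightarrow> nat \<Rightarrow> (bool list \<Rightarrow> real) \<Rightarrow> real" where
  "word_expectation q \<theta> n f = (\<Sum>xs | length xs = n. word_prob q \<theta> xs * f xs)"

lemma finite_words: "finite {xs :: bool list. length xs = n}"
  using finite_lists_length_eq[of "UNIV :: bool set" n] by simp

lemma word_expectation_0: "word_expectation q \<theta> 0 f = f []"
  by (simp add: word_expectation_def)

lemma word_expectation_Suc:
  "word_expectation q \<theta> (Suc n) f =
     \<theta> * word_expectation q \<theta> n (\<lambda>xs. f (True # xs)) +
     (1 - \<theta>) * word_expectation q (\<theta> * q) n (\<lambda>xs. f (False # xs))"
proof -
  let ?W = "{xs :: bool list. length xs = n}"
  have "{xs. length xs = Suc n} = Cons True ` ?W \<union> Cons False ` ?W"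
    by (auto simp: length_Suc_conv image_iff)
  then have "word_expectation q \<theta> (Suc n) f =
      (\<Sum>xs\<in>Cons True ` ?W. word_prob q \<theta> xs * f xs) +
      (\<Sum>xs\<in>Cons False ` ?W. word_prob q \<theta> xs * f xs)"
    unfolding word_expectation_def using finite_words[of n]
    by (simp only:) (rule sum.union_disjoint, auto)
  also have "\<dots> = (\<Sum>xs\<in>?W. \<theta> * (word_prob q \<theta> xs * f (True # xs))) +
      (\<Sum>xs\<in>?W. (1 - \<theta>) * (word_prob q (\<theta> * q) xs * f (False # xs)))"
    by (simp add: sum.reindex mult.assoc)
  finally show ?thesis
    by (simp add: word_expectation_def sum_distrib_left)
qed

lemma word_expectation_diff:
  "word_expectation q \<theta> n (\<lambda>xs. f xs - g xs) =
     word_expectation q \<theta> n f - word_expectation q \<theta> n g"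
  by (simp add: word_expectation_def right_diff_distrib sum_subtractf)

lemma word_expectation_cmult:
  "word_expectation q \<theta> n (\<lambda>xs. c * f xs) = c * word_expectation q \<theta> n f"
  by (simp add: word_expectation_def sum_distrib_left mult_ac)

lemma word_expectation_sum:
  "word_expectation q \<theta> n (\<lambda>xs. \<Sum>i\<in>I. f i xs) = (\<Sum>i\<in>I. word_expectation q \<theta> n (f i))"
  unfolding word_expectation_def by (subst sum.swap) (simp add: sum_distrib_left)

text \<open>The first-trial recursion is iterated along successes only. The failure branch is the
  summand \<open>j = 0\<close>; the success branch keeps the parameter \<open>\<theta>\<close> and
  lengthens the prefix of ones, which is the induction hypothesis for
  \<open>\<lambda>xs. f (True # xs)\<close>.\<close>

lemma word_expectation_leading_ones:
  "word_expectation q \<theta> n f =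
     (\<Sum>j<n. \<theta> ^ j * (1 - \<theta>) *
        word_expectation q (\<theta> * q) (n - Suc j) (\<lambda>ys. f (replicate j True @ False # ys))) +
     \<theta> ^ n * f (replicate n True)"
proof (induction n arbitrary: f)
  case 0
  then show ?case by (simp add: word_expectation_0)
next
  case (Suc n)
  show ?case
    unfolding word_expectation_Suc[of q \<theta> n f] Suc.IH[of "\<lambda>xs. f (True # xs)"] sum.lessThan_Suc_shift
    by (simp add: sum_distrib_left algebra_simps)
qed

section \<open>Expectations of a function of the run count: expansion, boundary values,
  recurrence\<close>

definition run_expectation :: "real \<Rightarrow> real \<Rightarrow> nat \<Rightarrow> nat \<Rightarrow> (real \<Rightarrow> real) \<Rightarrow> real" where
  "run_expectation q \<theta> n k g = word_expectation q \<theta> n (\<lambda>xs. g (real (runs k xs)))"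

text \<open>An arbitrary \<open>g\<close> treats both kinds of moments at once, and turns the extra
  run from a leading block of length \<open>k\<close> into a shift of the argument of
  \<open>g\<close>.\<close>

lemma run_expectation_leading_ones:
  assumes "k \<ge> 1"
  shows "run_expectation q \<theta> n k g =
     (\<Sum>j<n. \<theta> ^ j * (1 - \<theta>) *
        run_expectation q (\<theta> * q) (n - Suc j) k (\<lambda>c. g (of_bool (j = k) + c))) +
     \<theta> ^ n * g (of_bool (n = k))"
  unfolding run_expectation_def
  by (subst word_expectation_leading_ones)
    (simp only: runs_split[OF assms] runs_replicate[OF assms] of_nat_add of_nat_of_bool)

lemma run_expectation_eq_0:
  assumes "n < k" "g 0 = 0"
  shows "run_expectation q \<theta> n k g = 0"
  using assms by (simp add: run_expectation_def word_expectation_def runs_eq_0)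

text \<open>If a failure ends the leading block, the block and the tail are both shorter than
  \<open>k\<close>, so there is no run and \<open>g 0 = 0\<close> removes the term. Only the word of
  all ones remains.\<close>

lemma run_expectation_diag:
  assumes "k \<ge> 1" "g 0 = 0"
  shows "run_expectation q \<theta> k k g = \<theta> ^ k * g 1"
proof -
  have "run_expectation q (\<theta> * q) (k - Suc j) k (\<lambda>c. g (of_bool (j = k) + c)) = 0" if "j < k" for j
    using that assms by (intro run_expectation_eq_0) auto
  then show ?thesis
    by (subst run_expectation_leading_ones[OF assms(1)]) simp
qed

lemma run_expectation_0: "k \<ge> 1 \<Longrightarrow> run_expectation q \<theta> 0 k g = g 0"
  by (simp add: run_expectation_def word_expectation_0 runs_eq_0)

text \<open>Only two words contain a run of length \<open>k\<close>: a failure followed by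
  \<open>k\<close> ones, of weight \<open>(1 - \<theta>) * (\<theta> * q) ^ k\<close>, and
  \<open>k\<close> ones followed by a failure, of weight
  \<open>\<theta> ^ k * (1 - \<theta>)\<close>. They come from the summands \<open>j = 0\<close> and
  \<open>j = k\<close>.\<close>

lemma run_expectation_Suc_diag:
  assumes "k \<ge> 1" "g 0 = 0"
  shows "run_expectation q \<theta> (k + 1) k g = \<theta> ^ k * (1 - \<theta>) * (1 + q ^ k) * g 1"
proof -
  let ?F = "\<lambda>j. \<theta> ^ j * (1 - \<theta>) *
    run_expectation q (\<theta> * q) (Suc k - Suc j) k (\<lambda>c. g (of_bool (j = k) + c))"
  \<comment> \<open>Strictly between \<open>0\<close> and \<open>k\<close>, neither the block of
    length \<open>j\<close> nor the tail of length \<open>k - j\<close> reaches length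
    \<open>k\<close>.\<close>
  have "?F j = 0" if "j \<in> {..<Suc k} - {0, k}" for j
  proof -
    have "run_expectation q (\<theta> * q) (Suc k - Suc j) k (\<lambda>c. g (of_bool (j = k) + c)) = 0"
      using that assms by (intro run_expectation_eq_0) auto
    then show ?thesis by simp
  qed
  then have "sum ?F {..<Suc k} = sum ?F {0, k}"
    by (intro sum.mono_neutral_right) auto
  also have "\<dots> = ?F 0 + ?F k"
    using assms(1) by simp
  also have "\<dots> = (1 - \<theta>) * ((\<theta> * q) ^ k * g 1) + \<theta> ^ k * (1 - \<theta>) * g 1"
    using assms by (simp add: run_expectation_diag run_expectation_0)
  finally show ?thesis
    using assms
    by (subst run_expectation_leading_ones[OF assms(1)])
      (simp add: power_mult_distrib algebra_simps)
qed

lemma run_expectation_rec: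
  assumes k: "k \<ge> 1" and n: "n > k + 1" and h: "\<And>c. h c = g (1 + c) - g c"
  shows "run_expectation q \<theta> n k g =
     \<theta> * run_expectation q \<theta> (n - 1) k g + (1 - \<theta>) * (run_expectation q (\<theta> * q) (n - 1) k g +
       \<theta> ^ k * run_expectation q (\<theta> * q) (n - k - 1) k h -
       \<theta> ^ (k + 1) * run_expectation q (\<theta> * q) (n - k - 2) k h)"
proof -
  obtain N where N: "n = Suc N"
    using n by (cases n) auto
  obtain l where l: "k = Suc l"
    using k by (cases k) auto
  \<comment> \<open>The flag \<open>b\<close> says whether the block just ended counts as a run. It
    is kept apart from \<open>j\<close> because the two expansions below raise the count at
    different indices.\<close>
  define F where "F = (\<lambda>j b. run_expectation q (\<theta> * q) (N - Suc j) k (\<lambda>c. g (of_bool b + c)))"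
  define D where "D = (\<lambda>j. run_expectation q (\<theta> * q) (N - Suc j) k h)"
  have D: "F j True = F j False + D j" for j
    using word_expectation_diff[of q "\<theta> * q" "N - Suc j" "\<lambda>xs. g (1 + real (runs k xs))" "\<lambda>xs. g (real (runs k xs))"]
    by (simp add: F_def D_def run_expectation_def h)
  \<comment> \<open>The summand \<open>j = 0\<close> is split off, unraised since
    \<open>k \<ge> 1\<close>, and the rest is reindexed by one. The tails then have the same lengths
    as in \<open>B\<close>, while the raised index moves from \<open>k\<close> to
    \<open>l = k - 1\<close>.\<close>
  have A: "run_expectation q \<theta> n k g = (1 - \<theta>) * run_expectation q (\<theta> * q) N k g +
     (\<Sum>j<N. \<theta> * (\<theta> ^ j * (1 - \<theta>) * F j (j = l))) + \<theta> ^ n * g 0"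
    unfolding N
    by (subst run_expectation_leading_ones[OF k], subst sum.lessThan_Suc_shift)
      (use n N l in \<open>simp add: F_def algebra_simps\<close>)
  have B: "\<theta> * run_expectation q \<theta> N k g =
     (\<Sum>j<N. \<theta> * (\<theta> ^ j * (1 - \<theta>) * F j (j = k))) + \<theta> ^ n * g 0"
    by (subst run_expectation_leading_ones[OF k])
      (use n N in \<open>simp add: F_def algebra_simps sum_distrib_left\<close>)
  have "(\<Sum>j<N. \<theta> * (\<theta> ^ j * (1 - \<theta>) * F j (j = l))) - (\<Sum>j<N. \<theta> * (\<theta> ^ j * (1 - \<theta>) * F j (j = k)))
     = (\<Sum>j<N. (if j = l then \<theta> * (\<theta> ^ j * (1 - \<theta>) * D j) else 0) -
                (if j = k then \<theta> * (\<theta> ^ j * (1 - \<theta>) * D j) else 0))"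
    unfolding sum_subtractf[symmetric] by (intro sum.cong) (auto simp: D l algebra_simps)
  \<comment> \<open>The bound \<open>n > k + 1\<close> gives \<open>k < N\<close>, so both indices
    \<open>l\<close> and \<open>k\<close> occur in the sum.\<close>
  also have "\<dots> = \<theta> * (\<theta> ^ l * (1 - \<theta>) * D l) - \<theta> * (\<theta> ^ k * (1 - \<theta>) * D k)"
    using n N l by (simp add: sum_subtractf)
  finally have C: "run_expectation q \<theta> n k g - \<theta> * run_expectation q \<theta> N k g =
     (1 - \<theta>) * run_expectation q (\<theta> * q) N k g +
     (\<theta> * (\<theta> ^ l * (1 - \<theta>) * D l) - \<theta> * (\<theta> ^ k * (1 - \<theta>) * D k))"
    using A B by linarith
  have "D l = run_expectation q (\<theta> * q) (n - k - 1) k h" "D k = run_expectation q (\<theta> * q) (n - k - 2) k h"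
    by (simp_all add: D_def N l)
  then show ?thesis
    using C by (simp add: N l algebra_simps)
qed

section \<open>Forward differences of falling factorials and powers\<close>

lemma falling_factorial_diff:
  fixes c :: real
  assumes "r \<ge> 1"
  shows "real r * (\<Prod>i<r - 1. c - real i) = (\<Prod>i<r. 1 + c - real i) - (\<Prod>i<r. c - real i)"
proof -
  obtain s where r: "r = Suc s"
    using assms by (cases r) auto
  \<comment> \<open>The shifted and the unshifted product share the factor
    \<open>\<Prod>i<s. c - real i\<close>; their remaining factors \<open>1 + c\<close> and
    \<open>c - real s\<close> differ by \<open>real r\<close>.\<close>
  have "(\<Prod>i<Suc s. 1 + c - real i) = (1 + c) * (\<Prod>i<s. c - real i)"
    unfolding prod.lessThan_Suc_shift by simp
  then show ?thesis
    by (simp add: r algebra_simps)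
qed

text \<open>The factor with \<open>i = 1\<close> vanishes as soon as \<open>r \<ge> 2\<close>. This
  is the source of the Kronecker delta in the boundary values.\<close>

lemma falling_factorial_one:
  assumes "r \<ge> 1"
  shows "(\<Prod>i<r. 1 - real i) = (if r = 1 then 1 else 0)"
proof (cases "r = 1")
  case False
  then have "\<exists>i\<in>{..<r}. 1 - real i = 0"
    using assms by (intro bexI[of _ 1]) auto
  then show ?thesis
    using False by (simp add: prod_zero_iff)
qed simp

text \<open>The sum is the binomial expansion of \<open>(1 + c) ^ r\<close> without its top term
  \<open>c ^ r\<close>.\<close>

lemma power_diff_binomial:
  fixes c :: real
  assumes "r \<ge> 1"
  shows "(\<Sum>i=0..r - 1. real (r choose i) * c ^ i) = (1 + c) ^ r - c ^ r"
proof -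
  obtain s where r: "r = Suc s"
    using assms by (cases r) auto
  have "(1 + c) ^ r = (\<Sum>i\<le>r. real (r choose i) * c ^ i)"
    using binomial_ring[of c 1 r] by (simp add: add.commute)
  then show ?thesis
    by (simp add: r atLeast0AtMost)
qed

section \<open>From the probability space to words\<close>

definition trial_word :: "(nat \<Rightarrow> 'a \<Rightarrow> nat) \<Rightarrow> nat \<Rightarrow> 'a \<Rightarrow> bool list" where
  "trial_word X n \<omega> = map (\<lambda>m. X m \<omega> = 1) [1..<Suc n]"

lemma trial_word_Suc: "trial_word X (Suc n) \<omega> = trial_word X n \<omega> @ [X (Suc n) \<omega> = 1]"
  by (simp add: trial_word_def)

text \<open>Matches the exponent of \<open>q\<close> in \<open>q_sequence\<close> with the one in
  \<open>word_prob_snoc\<close>.\<close>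

lemma count_list_False_conv_sum:
  "count_list xs False = (\<Sum>m\<in>{1..<Suc (length xs)}. 1 - of_bool (xs ! (m - 1)))"
proof (induction xs rule: rev_induct)
  case (snoc x xs)
  have "(\<Sum>m\<in>{1..<Suc (length xs)}. 1 - of_bool ((xs @ [x]) ! (m - 1))) =
        (\<Sum>m\<in>{1..<Suc (length xs)}. 1 - of_bool (xs ! (m - 1)) :: nat)"
    by (intro sum.cong) (auto simp: nth_append)
  then show ?case
    using snoc by simp
qed simp

context
  fixes M :: "'a measure" and X :: "nat \<Rightarrow> 'a \<Rightarrow> nat" and \<theta> q :: real
  assumes qs: "q_sequence M X \<theta> q"
begin

interpretation prob_space M
  using qs by (simp add: q_sequence_def)

lemma q_sequence_values: "j \<ge> 1 \<Longrightarrow> \<omega> \<in> space M \<Longrightarrow> X j \<omega> \<in> {0, 1}"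
  using qs measurable_space[of "X j" M "count_space {0, 1}"] by (auto simp: q_sequence_def)

lemma q_sequence_sets: "j \<ge> 1 \<Longrightarrow> {\<omega> \<in> space M. X j \<omega> = 1} \<in> sets M"
  using qs measurable_sets[of "X j" M "count_space {0, 1}" "{1}"]
  by (auto simp: q_sequence_def vimage_def Int_def conj_commute)

lemma trial_word_sets: "{\<omega> \<in> space M. trial_word X n \<omega> = xs} \<in> sets M"
proof (induction n arbitrary: xs)
  case 0
  then show ?case by (simp add: trial_word_def)
next
  case (Suc n)
  show ?case
  proof (cases xs rule: rev_cases)
    case Nil
    then show ?thesis by (simp add: trial_word_Suc)
  next
    case (snoc ys y)
    define B where "B = {\<omega> \<in> space M. X (Suc n) \<omega> = 1}"
    have "B \<in> sets M"
      unfolding B_def by (rule q_sequence_sets) simp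
    moreover have "{\<omega> \<in> space M. trial_word X (Suc n) \<omega> = xs} =
      {\<omega> \<in> space M. trial_word X n \<omega> = ys} \<inter> (if y then B else space M - B)"
      by (auto simp: snoc trial_word_Suc B_def)
    ultimately show ?thesis
      using Suc.IH by (auto intro!: sets.Int)
  qed
qed

text \<open>A letter only records whether a trial equals \<open>1\<close>, but this fixes the trial
  because its values are \<open>0\<close> and \<open>1\<close>. The resulting event has the form of
  the histories in \<open>q_sequence\<close>.\<close>

lemma trial_word_eq_iff:
  assumes "\<omega> \<in> space M" "length xs = n"
  shows "trial_word X n \<omega> = xs \<longleftrightarrow> (\<forall>m\<in>{1..<Suc n}. X m \<omega> = of_bool (xs ! (m - 1)))"
proof -
  have "trial_word X n \<omega> = xs \<longleftrightarrow> (\<forall>i<n. (X (Suc i) \<omega> = 1) = xs ! i)"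
    using assms(2) by (auto simp: list_eq_iff_nth_eq trial_word_def simp del: upt_Suc)
  also have "\<dots> \<longleftrightarrow> (\<forall>i<n. X (Suc i) \<omega> = of_bool (xs ! i))"
  proof -
    have "X (Suc i) \<omega> = 0 \<or> X (Suc i) \<omega> = 1" for i
      using q_sequence_values[OF _ assms(1), of "Suc i"] by simp
    then have "(X (Suc i) \<omega> = 1) = b \<longleftrightarrow> X (Suc i) \<omega> = of_bool b" for i b
      by (metis (full_types) of_bool_eq(1,2) zero_neq_one)
    then show ?thesis by simp
  qed
  also have "\<dots> \<longleftrightarrow> (\<forall>m\<in>{1..<Suc n}. X m \<omega> = of_bool (xs ! (m - 1)))"
  proof -
    have "{1..<Suc n} = Suc ` {..<n}"
      by (simp add: image_Suc_lessThan atLeastLessThanSuc_atLeastAtMost)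
    then show ?thesis by (simp only: Set.ball_simps diff_Suc_1) (simp only: Ball_def lessThan_iff)
  qed
  finally show ?thesis .
qed

text \<open>Induction on the last letter: the conditional law in \<open>q_sequence\<close> gives the
  factor for a final success, complementation within the history gives the one for a failure, and
  \<open>word_prob_snoc\<close> has the same two factors.\<close>

lemma prob_trial_word:
  "length xs = n \<Longrightarrow> prob {\<omega> \<in> space M. trial_word X n \<omega> = xs} = word_prob q \<theta> xs"
proof (induction n arbitrary: xs)
  case 0
  then show ?case by (simp add: trial_word_def prob_space)
next
  case (Suc n)
  obtain ys y where xs: "xs = ys @ [y]"
    using Suc.prems by (cases xs rule: rev_cases) auto
  then have len: "length ys = n"
    using Suc.prems by simp
  define A where "A = {\<omega> \<in> space M. trial_word X n \<omega> = ys}"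
  define B where "B = {\<omega> \<in> space M. X (Suc n) \<omega> = 1}"
  have A_sets: "A \<in> sets M"
    unfolding A_def by (rule trial_word_sets)
  have B_sets: "B \<in> sets M"
    unfolding B_def by (rule q_sequence_sets) simp
  have PA: "prob A = word_prob q \<theta> ys"
    unfolding A_def by (rule Suc.IH[OF len])
  have AB: "prob (A \<inter> B) = prob A * (\<theta> * q ^ count_list ys False)"
  \<comment> \<open>The law of the next trial is given only for histories of positive probability;
    for a null history both sides vanish.\<close>
  proof (cases "prob A = 0")
    case True
    then show ?thesis
      using finite_measure_mono[of "A \<inter> B" A] A_sets by (simp add: measure_le_0_iff)
  next
    case False
    define x where "x = (\<lambda>m. of_bool (ys ! (m - 1)) :: nat)"
    have A: "A = {\<omega> \<in> space M. \<forall>m\<in>{1..<Suc n}. X m \<omega> = x m}"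
      unfolding A_def x_def by (intro Collect_cong conj_cong refl trial_word_eq_iff len)
    have "\<P>(\<omega> in M. \<forall>m\<in>{1..<Suc n}. X m \<omega> = x m) > 0"
      using False measure_nonneg[of M A] unfolding A by linarith
    moreover have "1 \<le> Suc n" by simp
    ultimately have "\<P>(\<omega> in M. X (Suc n) \<omega> = 1 \<bar> \<forall>m\<in>{1..<Suc n}. X m \<omega> = x m)
        = \<theta> * q ^ (\<Sum>m\<in>{1..<Suc n}. 1 - x m)"
      using qs unfolding q_sequence_def by blast
    moreover have "(\<Sum>m\<in>{1..<Suc n}. 1 - x m) = count_list ys False"
      unfolding count_list_False_conv_sum len x_def ..
    moreover have "{\<omega> \<in> space M. X (Suc n) \<omega> = 1 \<and> (\<forall>m\<in>{1..<Suc n}. X m \<omega> = x m)} = A \<inter> B"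
      unfolding A B_def by auto
    ultimately show ?thesis
      using False unfolding cond_prob_def A[symmetric] by (simp add: field_simps)
  qed
  have "{\<omega> \<in> space M. trial_word X (Suc n) \<omega> = xs} = (if y then A \<inter> B else A - A \<inter> B)"
    by (auto simp: xs trial_word_Suc A_def B_def)
  moreover have "prob (A - A \<inter> B) = prob A - prob (A \<inter> B)"
    using A_sets B_sets by (intro finite_measure_Diff) auto
  ultimately show ?case
    by (simp add: xs word_prob_snoc AB PA algebra_simps)
qed

lemma expectation_trial_word:
  "(\<integral>\<omega>. f (trial_word X n \<omega>) \<partial>M) = word_expectation q \<theta> n f"
proof -
  let ?W = "{xs :: bool list. length xs = n}"
  let ?A = "\<lambda>xs. {\<omega> \<in> space M. trial_word X n \<omega> = xs}"
  \<comment> \<open>A trial word takes finitely many values, so the integrand is a finite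
    combination of indicators of measurable events.\<close>
  have "(\<integral>\<omega>. f (trial_word X n \<omega>) \<partial>M) = (\<integral>\<omega>. (\<Sum>xs\<in>?W. f xs * indicator (?A xs) \<omega>) \<partial>M)"
  proof (rule Bochner_Integration.integral_cong[OF refl])
    fix \<omega> assume "\<omega> \<in> space M"
    then have "(\<Sum>xs\<in>?W. f xs * indicator (?A xs) \<omega>) =
        (\<Sum>xs\<in>?W. if xs = trial_word X n \<omega> then f xs else 0)"
      by (intro sum.cong) (auto simp: indicator_def)
    then show "f (trial_word X n \<omega>) = (\<Sum>xs\<in>?W. f xs * indicator (?A xs) \<omega>)"
      using finite_words[of n] by (simp add: trial_word_def)
  qed
  also have "\<dots> = (\<Sum>xs\<in>?W. f xs * prob (?A xs))"
    by (subst Bochner_Integration.integral_sum)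
      (auto intro!: integrable_mult_right integrable_real_indicator
            simp: trial_word_sets emeasure_eq_measure sets.Int_space_eq2[OF trial_word_sets])
  also have "\<dots> = word_expectation q \<theta> n f"
    unfolding word_expectation_def by (intro sum.cong) (auto simp: prob_trial_word)
  finally show ?thesis .
qed

text \<open>The result depends on the parameters alone, so the two unrelated probability spaces of
  the theorem become comparable.\<close>

lemma expectation_success_runs:
  "(\<integral>\<omega>. g (real (success_runs n k (\<lambda>m. X m \<omega>))) \<partial>M) = run_expectation q \<theta> n k g"
proof -
  have "success_runs n k (\<lambda>m. X m \<omega>) = runs k (trial_word X n \<omega>)" if "\<omega> \<in> space M" for \<omega>
  proof -
    have len: "length (trial_word X n \<omega>) = n"
      by (simp add: trial_word_def)
    show ?thesis
      unfolding runs_def len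
      using trial_word_eq_iff[OF that len] by (intro success_runs_cong) auto
  qed
  then have "(\<integral>\<omega>. g (real (success_runs n k (\<lambda>m. X m \<omega>))) \<partial>M) =
      (\<integral>\<omega>. g (real (runs k (trial_word X n \<omega>))) \<partial>M)"
    by (intro Bochner_Integration.integral_cong) auto
  then show ?thesis
    using expectation_trial_word[of "\<lambda>xs. g (real (runs k xs))" n]
    by (simp add: run_expectation_def)
qed

lemma run_factorial_moment_eq:
  "run_factorial_moment M X r n k = run_expectation q \<theta> n k (\<lambda>c. \<Prod>i<r. c - real i)"
  unfolding run_factorial_moment_def by (rule expectation_success_runs)

lemma run_moment_eq: "run_moment M X r n k = run_expectation q \<theta> n k (\<lambda>c. c ^ r)"
  unfolding run_moment_def by (rule expectation_success_runs)

end

section \<open>Recurrences and boundary values for both moments\<close>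

theorem corollary3p2:
  fixes \<theta> q :: real and k :: nat
    and M :: "'a measure" and X :: "nat \<Rightarrow> 'a \<Rightarrow> nat"
    and M' :: "'b measure" and X' :: "nat \<Rightarrow> 'b \<Rightarrow> nat"
  assumes "0 < q" "q \<le> 1" "0 \<le> \<theta>" "\<theta> \<le> 1" "k \<ge> 1"
    and "q_sequence M X \<theta> q"
    and "q_sequence M' X' (\<theta> * q) q"
  defines "\<rho> \<equiv> (\<lambda>r n. run_factorial_moment M X r n k)"
    and "\<rho>' \<equiv> (\<lambda>r n. run_factorial_moment M' X' r n k)"
    and "\<nu> \<equiv> (\<lambda>r n. run_moment M X r n k)"
    and "\<nu>' \<equiv> (\<lambda>r n. run_moment M' X' r n k)"
  shows
    "(\<forall>n r. n > k + 1 \<and> r \<ge> 1 \<longrightarrow>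
        \<rho> r n = \<theta> * \<rho> r (n - 1)
          + (1 - \<theta>) * (\<rho>' r (n - 1)
              + \<theta> ^ k * real r * \<rho>' (r - 1) (n - k - 1)
              - \<theta> ^ (k + 1) * real r * \<rho>' (r - 1) (n - k - 2)))
   \<and> (\<forall>r\<ge>1. (\<forall>n<k. \<rho> r n = 0)
          \<and> \<rho> r k = \<theta> ^ k * (if r = 1 then 1 else 0)
          \<and> \<rho> r (k + 1) = \<theta> ^ k * (1 - \<theta>) * (1 + q ^ k) * (if r = 1 then 1 else 0))
   \<and> (\<forall>n r. n > k + 1 \<and> r \<ge> 1 \<longrightarrow>
        \<nu> r n = \<theta> * \<nu> r (n - 1)
          + (1 - \<theta>) * (\<nu>' r (n - 1)
              + \<theta> ^ k * (\<Sum>i = 0..r - 1. real (r choose i) * \<nu>' i (n - k - 1))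
              - \<theta> ^ (k + 1) * (\<Sum>i = 0..r - 1. real (r choose i) * \<nu>' i (n - k - 2))))
   \<and> (\<forall>r\<ge>1. (\<forall>n<k. \<nu> r n = 0)
          \<and> \<nu> r k = \<theta> ^ k
          \<and> \<nu> r (k + 1) = \<theta> ^ k * (1 - \<theta>) * (1 + q ^ k))"
proof (intro conjI allI impI; (elim conjE)?)
  note eqs = \<rho>_def \<rho>'_def \<nu>_def \<nu>'_def
    run_factorial_moment_eq[OF assms(6)] run_factorial_moment_eq[OF assms(7)]
    run_moment_eq[OF assms(6)] run_moment_eq[OF assms(7)]
  \<comment> \<open>The forward differences are \<open>real r\<close> times a falling factorial of
    order \<open>r - 1\<close> and a binomial sum of lower powers. By linearity,
    \<open>scale\<close> and \<open>binom\<close> express their expectations through moments of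
    lower order.\<close>
  have scale: "run_expectation q (\<theta> * q) m k (\<lambda>c. real r * g c) =
      real r * run_expectation q (\<theta> * q) m k g" for m r g
    by (simp add: run_expectation_def word_expectation_cmult)
  have binom: "run_expectation q (\<theta> * q) m k (\<lambda>c. \<Sum>i=0..r - 1. real (r choose i) * c ^ i) =
      (\<Sum>i=0..r - 1. real (r choose i) * run_expectation q (\<theta> * q) m k (\<lambda>c. c ^ i))" for m r
    by (simp add: run_expectation_def word_expectation_sum word_expectation_cmult)
  fix n r :: nat
  {
    assume n: "n > k + 1" and r: "r \<ge> 1"
    show "\<rho> r n = \<theta> * \<rho> r (n - 1) + (1 - \<theta>) * (\<rho>' r (n - 1)
              + \<theta> ^ k * real r * \<rho>' (r - 1) (n - k - 1)
              - \<theta> ^ (k + 1) * real r * \<rho>' (r - 1) (n - k - 2))"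
      using run_expectation_rec[where g = "\<lambda>c. \<Prod>i<r. c - real i" and q = q and \<theta> = \<theta>,
          OF assms(5) n falling_factorial_diff[OF r]]
      unfolding eqs scale by (simp only: mult.assoc)
    show "\<nu> r n = \<theta> * \<nu> r (n - 1) + (1 - \<theta>) * (\<nu>' r (n - 1)
              + \<theta> ^ k * (\<Sum>i = 0..r - 1. real (r choose i) * \<nu>' i (n - k - 1))
              - \<theta> ^ (k + 1) * (\<Sum>i = 0..r - 1. real (r choose i) * \<nu>' i (n - k - 2)))"
      using run_expectation_rec[where g = "\<lambda>c. c ^ r" and q = q and \<theta> = \<theta>,
          OF assms(5) n power_diff_binomial[OF r]]
      unfolding eqs binom .
  next
    assume r: "r \<ge> 1"
    \<comment> \<open>This is the condition \<open>g 0 = 0\<close> of the boundary lemmas; the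
      falling factorial vanishes through its factor \<open>i = 0\<close>.\<close>
    have zero: "(\<Prod>i<r. 0 - real i) = 0" "(0::real) ^ r = 0"
      using r by (auto intro!: prod_zero)
    show "\<rho> r k = \<theta> ^ k * (if r = 1 then 1 else 0)"
      unfolding eqs run_expectation_diag[OF assms(5), of "\<lambda>c. \<Prod>i<r. c - real i", OF zero(1)]
        falling_factorial_one[OF r] ..
    show "\<rho> r (k + 1) = \<theta> ^ k * (1 - \<theta>) * (1 + q ^ k) * (if r = 1 then 1 else 0)"
      unfolding eqs run_expectation_Suc_diag[OF assms(5), of "\<lambda>c. \<Prod>i<r. c - real i", OF zero(1)]
        falling_factorial_one[OF r] ..
    show "\<nu> r k = \<theta> ^ k"
      unfolding eqs run_expectation_diag[OF assms(5), of "\<lambda>c. c ^ r", OF zero(2)] by simp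
    show "\<nu> r (k + 1) = \<theta> ^ k * (1 - \<theta>) * (1 + q ^ k)"
      unfolding eqs run_expectation_Suc_diag[OF assms(5), of "\<lambda>c. c ^ r", OF zero(2)] by simp
    assume n: "n < k"
    show "\<rho> r n = 0"
      unfolding eqs by (rule run_expectation_eq_0[where g = "\<lambda>c. \<Prod>i<r. c - real i", OF n zero(1)])
    show "\<nu> r n = 0"
      unfolding eqs by (rule run_expectation_eq_0[where g = "\<lambda>c. c ^ r", OF n zero(2)])
  }
qed

end
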